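(* Let $\tilde h_{1,n,m}\colon\{0,1\}^{nm\lceil\log|\Sigma|\rceil}\to\{0,1\}$ be the Boolean function associated with $h_{1,n,m}$. Then its approximate degree satisfies $\widetilde{\deg}(\tilde h_{1,n,m})=\tilde O(\sqrt n+\sqrt m)$.
   Context: Let $n,m$ be positive integers, $M=[n]\times[m]$ (a grid of cells with $n$ rows and $m$ columns), $\tilde M=M\cup\{\bot\}$ (pointers to cells, $\bot$ the null pointer). Let $T$ be the following fixed binary tree with $m$ leaves and $m-1$ internal nodes: if $m=2^r$, $T$ is the complete binary tree with $2^r$ leaves; if $2^r<m<2^{r+1}$, take the complete binary tree with $2^r$ leaves and add a pair of children to each of its $m-2^r$ leftmost leaves. Outgoing arcs are labeled 'left'/'right', leaves labeled $1,\dots,m$ from left to right, and $T(j)$ is the sequence of labels on the root-to-leaf-$j$ path. The alphabet is $\Sigma=\{0,1\}\times\tilde M\times\tilde M\times\tilde M$ with components $\mathrm{val},\mathrm{lpoint},\mathrm{rpoint},\mathrm{ipoint}$. The function $h_{1,n,m}\colon\Sigma^M\to\{0,1\}$ has $h_{1,n,m}(x)=1$ iff: (1) there is exactly one column $b$ with $\mathrm{val}(x_{i,b})=1$ for all $i\in[n]$ (marked column); (2) column $b$ contains a unique cell $a$ with $x_{a}\ne(1,\bot,\bot,\bot)$ (special element); (3) $\mathrm{ipoint}(x_{a})=a$; (4) for each column $j\ne b$, the path starting at $a$ and following $\mathrm{lpoint},\mathrm{rpoint}$ as specified by $T(j)$ exists (no $\bot$ on it) and ends at a cell $\ell_j$ in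 column $j$ with $\mathrm{val}(x_{\ell_j})=0$. The associated Boolean function: fix a surjection $\beta\colon\{0,1\}^{\lceil\log|\Sigma|\rceil}\to\Sigma$ and let $\tilde h_{1,n,m}(y)=h_{1,n,m}(\beta(y))$, with $\beta$ applied blockwise to each cell's block of bits. The approximate degree $\widetilde{\deg}(f)$ of a Boolean function $f$ is the minimum degree of a real multilinear polynomial $p$ with $|p(y)-f(y)|\le 1/10$ for all Boolean inputs $y$. $\tilde O$ hides factors polylogarithmic in $n,m$. *)

theory Defs
  imports Complex_Main
begin

type_synonym cell = "nat \<times> nat"   (* (row i, column j), 1-indexed *)
type_synonym sym = "bool \<times> cell option \<times> cell option \<times> cell option"
  (* (val, lpoint, rpoint, ipoint); None is the null pointer *)

definition val :: "sym \<Rightarrow> bool" where "val s = fst s"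
definition lpoint :: "sym \<Rightarrow> cell option" where "lpoint s = fst (snd s)"
definition rpoint :: "sym \<Rightarrow> cell option" where "rpoint s = fst (snd (snd s))"
definition ipoint :: "sym \<Rightarrow> cell option" where "ipoint s = snd (snd (snd s))"

definition grid :: "nat \<Rightarrow> nat \<Rightarrow> cell set" where
  "grid n m = {1..n} \<times> {1..m}"

definition ptrs :: "nat \<Rightarrow> nat \<Rightarrow> cell option set" where
  "ptrs n m = insert None (Some ` grid n m)"

definition Sigma_alph :: "nat \<Rightarrow> nat \<Rightarrow> sym set" where
  "Sigma_alph n m = UNIV \<times> ptrs n m \<times> ptrs n m \<times> ptrs n m"

(* the tree T: depth r of the complete part, r = floor(log2 m) *)
definition tree_depth :: "nat \<Rightarrow> nat" where
  "tree_depth m = (GREATEST r. 2 ^ r \<le> m)"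

(* r-bit binary expansion of k, most significant bit first; True = 'right' *)
definition binpath :: "nat \<Rightarrow> nat \<Rightarrow> bool list" where
  "binpath r k = map (\<lambda>i. odd (k div 2 ^ (r - 1 - i))) [0..<r]"

(* T(j): the root-to-leaf-j label sequence (False = left, True = right), leaves 1..m left to right.
   With e = m - 2^r, the leftmost e leaves of the complete tree with 2^r leaves get two children. *)
definition tree_path :: "nat \<Rightarrow> nat \<Rightarrow> bool list" where
  "tree_path m j = (let r = tree_depth m; e = m - 2 ^ r; t = j - 1 in
     if t < 2 * e then binpath r (t div 2) @ [odd t] else binpath r (t - e))"

fun follow :: "(cell \<Rightarrow> sym) \<Rightarrow> cell \<Rightarrow> bool list \<Rightarrow> cell option" where
  "follow x c [] = Some c"
| "follow x c (d # ds) =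
     (case (if d then rpoint (x c) else lpoint (x c)) of
        None \<Rightarrow> None
      | Some c' \<Rightarrow> follow x c' ds)"

definition h1 :: "nat \<Rightarrow> nat \<Rightarrow> (cell \<Rightarrow> sym) \<Rightarrow> bool" where
  "h1 n m x =
    (\<exists>b\<in>{1..m}.
       (\<forall>b'\<in>{1..m}. (\<forall>i\<in>{1..n}. val (x (i, b'))) \<longleftrightarrow> b' = b) \<and>
       (\<exists>a\<in>{1..n} \<times> {b}.
          (\<forall>a'\<in>{1..n} \<times> {b}. x a' \<noteq> (True, None, None, None) \<longleftrightarrow> a' = a) \<and>
          ipoint (x a) = Some a \<and>
          (\<forall>j\<in>{1..m} - {b}. \<exists>l. follow x a (tree_path m j) = Some l \<and>
                                  snd l = j \<and> \<not> val (x l))))"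

definition blk :: "nat \<Rightarrow> nat \<Rightarrow> nat" where
  "blk n m = nat \<lceil>log 2 (real (card (Sigma_alph n m)))\<rceil>"

definition encoding :: "nat \<Rightarrow> nat \<Rightarrow> (bool list \<Rightarrow> sym) \<Rightarrow> bool" where
  "encoding n m \<beta> \<longleftrightarrow> \<beta> ` {xs. length xs = blk n m} = Sigma_alph n m"

definition decode :: "nat \<Rightarrow> nat \<Rightarrow> (bool list \<Rightarrow> sym) \<Rightarrow> (nat \<Rightarrow> bool) \<Rightarrow> cell \<Rightarrow> sym" where
  "decode n m \<beta> y c = (let k = (fst c - 1) * m + (snd c - 1) in
      \<beta> (map (\<lambda>t. y (k * blk n m + t)) [0..<blk n m]))"

definition h1_tilde :: "nat \<Rightarrow> nat \<Rightarrow> (bool list \<Rightarrow> sym) \<Rightarrow> (nat \<Rightarrow> bool) \<Rightarrow> real" where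
  "h1_tilde n m \<beta> y = (if h1 n m (decode n m \<beta> y) then 1 else 0)"

definition mlpoly :: "nat \<Rightarrow> nat \<Rightarrow> (nat set \<Rightarrow> real) \<Rightarrow> (nat \<Rightarrow> bool) \<Rightarrow> real" where
  "mlpoly N d c y = (\<Sum>S\<in>{S. S \<subseteq> {..<N} \<and> card S \<le> d}. c S * (\<Prod>i\<in>S. if y i then 1 else 0))"

definition boolean_inputs :: "nat \<Rightarrow> (nat \<Rightarrow> bool) set" where
  "boolean_inputs N = {y. \<forall>i\<ge>N. \<not> y i}"

definition approx_deg :: "nat \<Rightarrow> ((nat \<Rightarrow> bool) \<Rightarrow> real) \<Rightarrow> nat" where
  "approx_deg N f = (LEAST d. \<exists>c. \<forall>y\<in>boolean_inputs N. \<bar>mlpoly N d c y - f y\<bar> \<le> 1/10)"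

end

theory Submission
  imports Defs
begin

text \<open>
  If \<open>h1 n m x\<close> holds, the special element \<open>a\<close> is unique: its column is all ones, while every
  other column contains the zero at the end of a tree path. So \<open>h1\<close> is the sum over all
  cells \<open>a\<close> of the indicator of ``\<open>a\<close> is the special element'', which is a conjunction of \<open>n + m\<close>
  conditions, each read off by a decision tree that visits \<open>O(log m)\<close> cells and hence of
  polylogarithmic degree. A conjunction of \<open>N\<close> bits is approximated within \<open>2 ^ - s\<close> by the \<open>s\<close>-th
  power of a normalised Chebyshev polynomial of degree about \<open>sqrt N\<close>, and \<open>s = O(log (n * m))\<close>
  makes the total error of the \<open>n * m\<close> summands at most \<open>1/10\<close>.
\<close>

section \<open>Functions of bounded degree on Boolean inputs\<close>

text \<open>Equality is demanded at every assignment \<open>y\<close>, not only on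
  \<open>boolean_inputs N\<close>, so the closure rules below carry no side condition on
  \<open>y\<close>.\<close>

definition degle :: "nat \<Rightarrow> nat \<Rightarrow> ((nat \<Rightarrow> bool) \<Rightarrow> real) \<Rightarrow> bool" where
  "degle N d f \<longleftrightarrow> (\<exists>c. \<forall>y. f y = mlpoly N d c y)"

lemma finite_bounded_subsets: "finite {S. S \<subseteq> {..<N::nat} \<and> card S \<le> d}"
  by (rule finite_subset[of _ "Pow {..<N}"]) auto

lemma degle_monomial:
  assumes "S \<subseteq> {..<N}" "card S \<le> d"
  shows "degle N d (\<lambda>y. a * (\<Prod>i\<in>S. if y i then 1 else 0))"
proof -
  have "a * (\<Prod>i\<in>S. if y i then 1 else 0) = mlpoly N d (\<lambda>U. if U = S then a else 0) y" for y
  proof -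
    have "mlpoly N d (\<lambda>U. if U = S then a else 0) y =
        (\<Sum>U\<in>{S. S \<subseteq> {..<N} \<and> card S \<le> d}.
           if U = S then a * (\<Prod>i\<in>U. if y i then 1 else 0) else 0)"
      unfolding mlpoly_def by (rule sum.cong) auto
    also have "\<dots> = a * (\<Prod>i\<in>S. if y i then 1 else 0)"
      using assms by (simp add: finite_bounded_subsets)
    finally show ?thesis by simp
  qed
  then show ?thesis unfolding degle_def by blast
qed

lemma degle_const: "degle N d (\<lambda>_. a)"
  using degle_monomial[of "{}" N d a] by simp

lemma degle_add:
  assumes "degle N d f" "degle N d g"
  shows "degle N d (\<lambda>y. f y + g y)"
proof -
  obtain c c' where "\<forall>y. f y = mlpoly N d c y" "\<forall>y. g y = mlpoly N d c' y"
    using assms unfolding degle_def by blast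
  then have "f y + g y = mlpoly N d (\<lambda>S. c S + c' S) y" for y
    by (simp add: mlpoly_def sum.distrib distrib_right)
  then show ?thesis unfolding degle_def by blast
qed

lemma degle_sum:
  assumes "\<And>i. i \<in> A \<Longrightarrow> degle N d (f i)"
  shows "degle N d (\<lambda>y. \<Sum>i\<in>A. f i y)"
  using assms
  by (induction A rule: infinite_finite_induct) (auto intro: degle_const degle_add)

text \<open>Bits are idempotent, so the product of the monomials of \<open>S\<close> and
  \<open>U\<close> is the monomial of \<open>S \<union> U\<close>. The product stays multilinear and
  degrees add.\<close>

lemma degle_mult:
  assumes "degle N d f" "degle N e g"
  shows "degle N (d + e) (\<lambda>y. f y * g y)"
proof -
  let ?mon = "\<lambda>S (y :: nat \<Rightarrow> bool). \<Prod>i\<in>S. if y i then 1 else 0 :: real"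
  let ?X = "\<lambda>d. {S. S \<subseteq> {..<N} \<and> card S \<le> d}"
  obtain c c' where c: "\<And>y. f y = mlpoly N d c y" and c': "\<And>y. g y = mlpoly N e c' y"
    using assms unfolding degle_def by blast
  have "?mon S y = of_bool (\<forall>i\<in>S. y i)" if "finite S" for S y
    using that by (induction S rule: finite_induct) auto
  then have mon: "?mon S y * ?mon U y = ?mon (S \<union> U) y" if "finite S" "finite U" for S U y
    using that by (auto simp: ball_Un)
  have "f y * g y = (\<Sum>S\<in>?X d. \<Sum>U\<in>?X e. (c S * c' U) * ?mon (S \<union> U) y)" for y
    unfolding c c' mlpoly_def sum_product
  proof (intro sum.cong refl)
    fix S U assume "S \<in> ?X d" "U \<in> ?X e"
    then have "finite S" "finite U" by (auto intro: finite_subset)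
    then show "c S * ?mon S y * (c' U * ?mon U y) = (c S * c' U) * ?mon (S \<union> U) y"
      by (simp flip: mon)
  qed
  moreover have "degle N (d + e) (\<lambda>y. \<Sum>S\<in>?X d. \<Sum>U\<in>?X e. (c S * c' U) * ?mon (S \<union> U) y)"
  proof (intro degle_sum degle_monomial)
    fix S U assume "S \<in> ?X d" "U \<in> ?X e"
    then show "S \<union> U \<subseteq> {..<N}" "card (S \<union> U) \<le> d + e"
      using card_Un_le[of S U] by auto
  qed
  ultimately show ?thesis by presburger
qed

lemma degle_mono:
  assumes "degle N d f" "d \<le> e"
  shows "degle N e f"
  \<comment> \<open>The constant 1, regarded as having degree \<open>e - d\<close>, pads the
    bound.\<close>
  using degle_mult[OF assms(1) degle_const[of N "e - d" 1]] assms(2) by simp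

lemma degle_cmult: "degle N d f \<Longrightarrow> degle N d (\<lambda>y. a * f y)"
  using degle_mult[OF degle_const[of N 0 a], of d f] by simp

lemma degle_power: "degle N d f \<Longrightarrow> degle N (s * d) (\<lambda>y. f y ^ s)"
  by (induction s) (auto intro: degle_const degle_mult)

text \<open>Branching on the first bit costs one degree per bit. As \<open>F\<close> is arbitrary,
  so may be the surjection \<open>\<beta>\<close> in later uses.\<close>

lemma degle_bits:
  assumes "\<forall>i\<in>set is. i < N"
  shows "degle N (length is) (\<lambda>y. F (map y is))"
  using assms
proof (induction "is" arbitrary: F)
  case Nil
  show ?case by (simp add: degle_const)
next
  case (Cons i "is")
  have i: "degle N 1 (\<lambda>y. a * (if y i then 1 else 0))" for a
    using degle_monomial[of "{i}" N 1 a] Cons.prems by simp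
  have IH: "degle N (length is) (\<lambda>y. G (map y is))" for G
    using Cons by simp
  have eq: "F (map y (i # is)) = 1 * (if y i then 1 else 0) * F (True # map y is)
      + (1 + (-1) * (if y i then 1 else 0)) * F (False # map y is)" for y
    by simp
  have "degle N (1 + length is) (\<lambda>y. 1 * (if y i then 1 else 0) * F (True # map y is)
      + (1 + (-1) * (if y i then 1 else 0)) * F (False # map y is))"
    by (intro degle_add degle_mult degle_const i
        IH[of "\<lambda>z. F (True # z)"] IH[of "\<lambda>z. F (False # z)"])
  then show ?case unfolding eq by simp
qed

lemma approx_deg_le:
  assumes "degle N d p" "\<And>y. \<bar>p y - f y\<bar> \<le> 1/10"
  shows "approx_deg N f \<le> d"
proof -
  obtain c where "\<And>y. p y = mlpoly N d c y"
    using assms(1) unfolding degle_def by blast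
  then have "\<exists>c. \<forall>y\<in>boolean_inputs N. \<bar>mlpoly N d c y - f y\<bar> \<le> 1/10"
    using assms(2) by (intro exI[of _ c]) auto
  then show ?thesis
    unfolding approx_deg_def by (rule Least_le)
qed

section \<open>Approximating conjunctions by Chebyshev polynomials\<close>

fun cheb :: "nat \<Rightarrow> real \<Rightarrow> real" where
  "cheb 0 x = 1"
| "cheb (Suc 0) x = x"
| "cheb (Suc (Suc d)) x = 2 * x * cheb (Suc d) x - cheb d x"

text \<open>The addition formulas for \<open>(d + 1) * t\<close> plus and minus \<open>t\<close> sum
  to the three-term recurrence. This form yields the bound on [-1, 1].\<close>

lemma cheb_cos: "cheb d (cos t) = cos (real d * t)"
proof (induction d "cos t" rule: cheb.induct)
  case (3 d)
  have "cos (real (Suc (Suc d)) * t) + cos (real d * t) = 2 * cos t * cos (real (Suc d) * t)"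
    using cos_add[of "real (Suc d) * t" t] cos_diff[of "real (Suc d) * t" t]
    by (simp add: algebra_simps)
  then show ?case using 3 by simp
qed simp_all

lemma abs_cheb_le_1: "\<bar>x\<bar> \<le> 1 \<Longrightarrow> \<bar>cheb d x\<bar> \<le> 1"
  using cheb_cos[of d "arccos x"] by (simp add: cos_arccos_abs)

text \<open>Both bounds go through one induction: by the recurrence each increment exceeds the
  previous one by \<open>2 * t * cheb (Suc d) (1 + t)\<close>, which is at least
  \<open>2 * t\<close>. Increments thus dominate the odd multiples of \<open>t\<close>, whose sum is
  \<open>d ^ 2 * t\<close>.\<close>

lemma cheb_growth:
  assumes "t \<ge> 0"
  shows "cheb d (1 + t) \<ge> 1 + real d ^ 2 * t"
    and "cheb (Suc d) (1 + t) - cheb d (1 + t) \<ge> (2 * real d + 1) * t"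
proof (induction d)
  case (Suc d)
  show 1: "1 + real (Suc d) ^ 2 * t \<le> cheb (Suc d) (1 + t)"
    using Suc by (simp add: power2_eq_square algebra_simps)
  have "1 \<le> cheb (Suc d) (1 + t)"
    by (rule order_trans[OF _ 1]) (use assms in simp)
  then have "2 * t * 1 \<le> 2 * t * cheb (Suc d) (1 + t)"
    using assms by (intro mult_left_mono) auto
  then show "(2 * real (Suc d) + 1) * t \<le> cheb (Suc (Suc d)) (1 + t) - cheb (Suc d) (1 + t)"
    using Suc(2) by (simp add: algebra_simps)
qed (use assms in auto)

lemma degle_cheb:
  assumes g: "degle N w g"
  shows "degle N (d * w) (\<lambda>y. cheb d (g y))"
proof (induction d rule: induct_nat_012)
  case (ge2 d)
  have "degle N (w + Suc d * w) (\<lambda>y. 2 * (g y * cheb (Suc d) (g y)) + (-1) * cheb d (g y))"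
    using ge2 g by (intro degle_add degle_cmult degle_mult) (auto intro: degle_mono)
  then show ?case by (simp add: algebra_simps)
qed (use g in \<open>auto intro: degle_const\<close>)

text \<open>The number of true conditions is scaled so that one failure already puts the argument in
  [0, 1], while full success gives \<open>1 + t\<close>, where \<open>cheb d\<close> is at least 2.
  Dividing by that value makes true inputs exact and leaves at most 1/2 elsewhere, which the power
  \<open>s\<close> shrinks.\<close>

lemma degle_conjunction:
  fixes P :: "'k \<Rightarrow> (nat \<Rightarrow> bool) \<Rightarrow> bool"
  assumes card: "card K \<ge> 2" and d: "card K \<le> d ^ 2"
    and P: "\<And>k. k \<in> K \<Longrightarrow> degle N w (\<lambda>y. of_bool (P k y))"
  shows "\<exists>q. degle N (s * (d * w)) q \<and>
    (\<forall>y. \<bar>q y - of_bool (\<forall>k\<in>K. P k y)\<bar> \<le> of_bool (\<not> (\<forall>k\<in>K. P k y)) * (1/2) ^ s)"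
proof -
  have K: "finite K" using card by (intro card_ge_0_finite) simp
  \<comment> \<open>With this \<open>t\<close>, a count of \<open>card K - 1\<close> is scaled to 1
    and a count of \<open>card K\<close> to \<open>1 + t\<close>.\<close>
  define t where "t = 1 / (real (card K) - 1)"
  have t: "t > 0" "t * (real (card K) - 1) = 1"
    using card by (auto simp: t_def)
  define g where "g = (\<lambda>y. t * (\<Sum>k\<in>K. of_bool (P k y)))"
  define q where "q = (\<lambda>y. ((1 / cheb d (1 + t)) * cheb d (g y)) ^ s)"
  have "real (card K) \<le> real (d ^ 2)"
    using d by (rule of_nat_mono)
  then have "real (card K) - 1 \<le> real d ^ 2"
    unfolding of_nat_power by linarith
  then have "1 \<le> real d ^ 2 * t"
    using mult_left_mono[of "real (card K) - 1" "real d ^ 2" t] t by (simp add: mult.commute)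
  then have T: "cheb d (1 + t) \<ge> 2"
    using cheb_growth(1)[of t d] t by linarith
  have "degle N (s * (d * w)) q"
    unfolding q_def g_def
    by (intro degle_power degle_cmult degle_cheb degle_sum P)
  moreover have "\<bar>q y - of_bool (\<forall>k\<in>K. P k y)\<bar> \<le> of_bool (\<not> (\<forall>k\<in>K. P k y)) * (1/2) ^ s" for y
  proof (cases "\<forall>k\<in>K. P k y")
    case True
    then have "g y = 1 + t"
      using t by (simp add: g_def algebra_simps)
    then have "q y = 1"
      using T by (simp add: q_def)
    then show ?thesis using True by simp
  next
    case False
    then obtain k where k: "k \<in> K" "\<not> P k y" by blast
    have "(\<Sum>k\<in>K. of_bool (P k y)) = (\<Sum>k\<in>K - {k}. of_bool (P k y) :: real)"
      using k K by (simp only: sum.remove) simp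
    also have "\<dots> \<le> (\<Sum>k\<in>K - {k}. 1)"
      by (intro sum_mono) auto
    also have "\<dots> = real (card K) - 1"
      using k K card by (simp add: of_nat_diff)
    finally have "g y \<le> t * (real (card K) - 1)"
      unfolding g_def using t by (intro mult_left_mono) auto
    moreover have "g y \<ge> 0"
      unfolding g_def using t by (intro mult_nonneg_nonneg sum_nonneg) auto
    ultimately have "\<bar>cheb d (g y)\<bar> \<le> 1"
      using t by (intro abs_cheb_le_1) auto
    then have "\<bar>1 / cheb d (1 + t) * cheb d (g y)\<bar> \<le> 1/2"
      using T by (simp add: abs_mult divide_simps)
    then have "\<bar>q y\<bar> \<le> (1/2) ^ s"
      unfolding q_def power_abs by (intro power_mono) auto
    then show ?thesis using False by (simp only: of_bool_eq) simp
  qed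
  ultimately show ?thesis by blast
qed

section \<open>Conditions on the decoded grid\<close>

text \<open>Any cell, on the grid or off it, is decoded from a list of exactly
  \<open>blk n m\<close> bits, which \<open>\<beta>\<close> maps into the alphabet.\<close>

lemma decode_in_Sigma: "encoding n m \<beta> \<Longrightarrow> decode n m \<beta> y c \<in> Sigma_alph n m"
  unfolding encoding_def decode_def Let_def by auto

lemma degle_cell:
  assumes "c \<in> grid n m"
  shows "degle (n * m * blk n m) (blk n m) (\<lambda>y. F (decode n m \<beta> y c))"
proof -
  \<comment> \<open>Successor form removes the truncated subtractions in \<open>decode\<close>; the
    cell then has row-major index \<open>i * m + j\<close>.\<close>
  obtain i j where c: "c = (Suc i, Suc j)" "i < n" "j < m"
    using assms by (cases c) (auto simp: grid_def gr0_conv_Suc Suc_le_eq dest!: Suc_le_D)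
  let ?k = "i * m + j"
  have "Suc ?k \<le> Suc i * m" using c by simp
  also have "\<dots> \<le> n * m" using c by (intro mult_le_mono1) simp
  finally have k: "Suc ?k * blk n m \<le> n * m * blk n m"
    by (intro mult_le_mono1)
  have "degle (n * m * blk n m) (length (map (\<lambda>t. ?k * blk n m + t) [0..<blk n m]))
      (\<lambda>y. F (\<beta> (map y (map (\<lambda>t. ?k * blk n m + t) [0..<blk n m]))))"
    by (rule degle_bits[of _ _ "\<lambda>z. F (\<beta> z)"]) (use k in auto)
  then show ?thesis
    by (simp add: decode_def c o_def)
qed

text \<open>Condition (4) for one column, with start cell and path left free so that induction along
  the path is possible.\<close>

definition reaches_zero :: "(cell \<Rightarrow> sym) \<Rightarrow> nat \<Rightarrow> cell \<Rightarrow> bool list \<Rightarrow> bool" where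
  "reaches_zero x j c p \<longleftrightarrow> (\<exists>l. follow x c p = Some l \<and> snd l = j \<and> \<not> val (x l))"

text \<open>Summing over the possible targets of the first pointer, at most one term survives. Each
  visited cell therefore adds \<open>blk n m\<close> to the degree; \<open>Suc\<close> accounts for
  the end cell, whose \<open>val\<close> is read.\<close>

lemma degle_reaches_zero:
  assumes enc: "encoding n m \<beta>" and "c \<in> grid n m"
  shows "degle (n * m * blk n m) (Suc (length p) * blk n m)
    (\<lambda>y. of_bool (reaches_zero (decode n m \<beta> y) j c p))"
  using assms(2)
proof (induction p arbitrary: c)
  case Nil
  then show ?case
    using degle_cell[of c n m "\<lambda>s. of_bool (snd c = j \<and> \<not> val s)" \<beta>]
    by (simp add: reaches_zero_def)
next
  case (Cons a p)
  define ptr where "ptr = (\<lambda>s. if a then rpoint s else lpoint s)"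
  \<comment> \<open>A non-null pointer stays on the grid, so the sum below misses no target.\<close>
  have ptr: "ptr (decode n m \<beta> y c) \<in> ptrs n m" for y
    using decode_in_Sigma[OF enc, of y c]
    by (auto simp: ptr_def Sigma_alph_def lpoint_def rpoint_def)
  have eq: "of_bool (reaches_zero (decode n m \<beta> y) j c (a # p)) =
      (\<Sum>c'\<in>grid n m. of_bool (ptr (decode n m \<beta> y c) = Some c') *
         of_bool (reaches_zero (decode n m \<beta> y) j c' p) :: real)" for y
  proof (cases "ptr (decode n m \<beta> y c)")
    case None
    then show ?thesis by (simp add: reaches_zero_def ptr_def)
  next
    case (Some c0)
    have "finite (grid n m)" by (simp add: grid_def)
    moreover have "c0 \<in> grid n m"
      using ptr[of y] Some by (auto simp: ptrs_def)
    moreover have "reaches_zero (decode n m \<beta> y) j c (a # p) = reaches_zero (decode n m \<beta> y) j c0 p"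
      using Some by (simp add: reaches_zero_def ptr_def)
    moreover have "(\<Sum>c'\<in>grid n m. of_bool (Some c0 = Some c') *
         of_bool (reaches_zero (decode n m \<beta> y) j c' p) :: real) =
       (\<Sum>c'\<in>grid n m. if c0 = c' then of_bool (reaches_zero (decode n m \<beta> y) j c' p) else 0)"
      by (rule sum.cong) auto
    ultimately show ?thesis using Some by simp
  qed
  have "degle (n * m * blk n m) (blk n m + Suc (length p) * blk n m)
      (\<lambda>y. \<Sum>c'\<in>grid n m. of_bool (ptr (decode n m \<beta> y c) = Some c') *
         of_bool (reaches_zero (decode n m \<beta> y) j c' p))"
    by (intro degle_sum degle_mult Cons.IH
        degle_cell[of c n m "\<lambda>s. of_bool (ptr s = Some _)" \<beta>] Cons.prems)
  then show ?case unfolding eq by simp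
qed

text \<open>\<open>Inl i\<close> is the condition on row \<open>i\<close> of the marked column, \<open>Inr j\<close> the condition on column \<open>j\<close>.\<close>

fun special_cond :: "nat \<Rightarrow> cell \<Rightarrow> nat + nat \<Rightarrow> (cell \<Rightarrow> sym) \<Rightarrow> bool" where
  "special_cond m a (Inl i) x =
     (if i = fst a then val (x a) \<and> ipoint (x a) = Some a
      else x (i, snd a) = (True, None, None, None))"
| "special_cond m a (Inr j) x = (j = snd a \<or> reaches_zero x j a (tree_path m j))"

definition special :: "nat \<Rightarrow> nat \<Rightarrow> (cell \<Rightarrow> sym) \<Rightarrow> cell \<Rightarrow> bool" where
  "special n m x a \<longleftrightarrow> (\<forall>k\<in>{1..n} <+> {1..m}. special_cond m a k x)"

lemma length_tree_path: "length (tree_path m j) \<le> Suc (tree_depth m)"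
  by (simp add: tree_path_def binpath_def Let_def)

text \<open>A tree path has at most \<open>tree_depth m + 1\<close> arcs, hence visits at most
  \<open>tree_depth m + 2\<close> cells; a row condition reads a single cell.\<close>

lemma degle_special_cond:
  assumes "encoding n m \<beta>" "a \<in> grid n m" "k \<in> {1..n} <+> {1..m}"
  shows "degle (n * m * blk n m) ((tree_depth m + 2) * blk n m)
    (\<lambda>y. of_bool (special_cond m a k (decode n m \<beta> y)))"
proof (cases k)
  case (Inl i)
  then have "(i, snd a) \<in> grid n m"
    using assms by (auto simp: grid_def)
  then have "degle (n * m * blk n m) (blk n m)
      (\<lambda>y. of_bool (special_cond m a k (decode n m \<beta> y)))"
    using degle_cell[of "(i, snd a)" n m "\<lambda>s. of_bool (if i = fst a
         then val s \<and> ipoint s = Some a else s = (True, None, None, None))" \<beta>] Inl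
    by (cases "i = fst a") auto
  then show ?thesis by (rule degle_mono) simp
next
  case (Inr j)
  have "degle (n * m * blk n m) ((tree_depth m + 2) * blk n m)
      (\<lambda>y. of_bool (reaches_zero (decode n m \<beta> y) j a (tree_path m j)))"
    using degle_reaches_zero[OF assms(1,2)]
    by (rule degle_mono) (use length_tree_path[of m j] in \<open>intro mult_le_mono1; simp\<close>)
  then show ?thesis using Inr by (cases "j = snd a") (auto intro: degle_const)
qed

section \<open>The special element and its uniqueness\<close>

lemma follow_in_grid:
  assumes "\<And>c. x c \<in> Sigma_alph n m" "c \<in> grid n m" "follow x c p = Some l"
  shows "l \<in> grid n m"
  using assms(2,3)
proof (induction p arbitrary: c)
  case (Cons a p)
  have "lpoint (x c) \<in> ptrs n m" "rpoint (x c) \<in> ptrs n m"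
    using assms(1)[of c] by (auto simp: Sigma_alph_def lpoint_def rpoint_def)
  with Cons show ?case
    by (auto simp: ptrs_def split: option.splits if_splits)
qed simp

lemma special_Inl: "special n m x a \<Longrightarrow> i \<in> {1..n} \<Longrightarrow> special_cond m a (Inl i) x"
  unfolding special_def by blast

lemma special_Inr: "special n m x a \<Longrightarrow> j \<in> {1..m} \<Longrightarrow> special_cond m a (Inr j) x"
  unfolding special_def by blast

lemma special_column:
  assumes "special n m x a" "i \<in> {1..n}"
  shows "val (x (i, snd a))"
  using special_Inl[OF assms] by (cases "i = fst a") (auto simp: val_def)

lemma special_other_column:
  assumes "\<And>c. x c \<in> Sigma_alph n m" "a \<in> grid n m" "special n m x a"
    and "j \<in> {1..m}" "j \<noteq> snd a"
  shows "\<exists>i\<in>{1..n}. \<not> val (x (i, j))"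
proof -
  obtain l where l: "follow x a (tree_path m j) = Some l" "snd l = j" "\<not> val (x l)"
    using special_Inr[OF assms(3,4)] assms(5) by (auto simp: reaches_zero_def)
  moreover have "l \<in> grid n m"
    using follow_in_grid assms(1,2) l(1) by blast
  ultimately show ?thesis by (auto simp: grid_def)
qed

text \<open>The column of \<open>a\<close> is all ones, but every column other than that of
  \<open>b\<close> contains a zero, so the columns agree. If the rows differed, the conditions of
  \<open>a\<close> would make \<open>ipoint (x b)\<close> null, while those of \<open>b\<close> make
  it \<open>Some b\<close>.\<close>

lemma special_unique:
  assumes x: "\<And>c. x c \<in> Sigma_alph n m"
    and a: "a \<in> grid n m" "special n m x a" and b: "b \<in> grid n m" "special n m x b"
  shows "a = b"
proof -
  have col: "snd a = snd b"
    using special_other_column[OF x b, of "snd a"] special_column[OF a(2)] a(1)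
    by (cases "snd a = snd b") (auto simp: grid_def)
  have "fst b \<in> {1..n}" using b(1) by (auto simp: grid_def)
  then have "fst a = fst b"
    using special_Inl[OF a(2), of "fst b"] special_Inl[OF b(2), of "fst b"] col
    by (cases a; cases b) (auto simp: ipoint_def split: if_splits)
  with col show ?thesis by (simp add: prod_eq_iff)
qed

text \<open>Uniqueness of the marked column is not among the conjuncts of \<open>special\<close>; it
  is recovered from the zeros at the ends of the tree paths.\<close>

lemma h1_iff_special:
  assumes x: "\<And>c. x c \<in> Sigma_alph n m"
  shows "h1 n m x \<longleftrightarrow> (\<exists>a\<in>grid n m. special n m x a)"
proof
  assume "h1 n m x"
  then obtain b a where b: "b \<in> {1..m}"
    and col: "\<forall>b'\<in>{1..m}. (\<forall>i\<in>{1..n}. val (x (i, b'))) \<longleftrightarrow> b' = b"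
    and a: "a \<in> {1..n} \<times> {b}"
    and uniq: "\<forall>a'\<in>{1..n} \<times> {b}. x a' \<noteq> (True, None, None, None) \<longleftrightarrow> a' = a"
    and ip: "ipoint (x a) = Some a"
    and path: "\<forall>j\<in>{1..m} - {b}. \<exists>l. follow x a (tree_path m j) = Some l \<and> snd l = j \<and> \<not> val (x l)"
    unfolding h1_def by blast
  obtain i where i: "a = (i, b)" "i \<in> {1..n}" using a by auto
  have "special n m x a"
    unfolding special_def
  proof
    fix k assume "k \<in> {1..n} <+> {1..m}"
    then show "special_cond m a k x"
    proof
      fix i' assume "i' \<in> {1..n}" "k = Inl i'"
      moreover have "val (x a)" using col b i by blast
      ultimately show ?thesis using uniq ip i by auto
    next
      fix j assume "j \<in> {1..m}" "k = Inr j"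
      then show ?thesis using path i by (auto simp: reaches_zero_def)
    qed
  qed
  then show "\<exists>a\<in>grid n m. special n m x a" using i b by (intro bexI[of _ a]) (auto simp: grid_def)
next
  assume "\<exists>a\<in>grid n m. special n m x a"
  then obtain a where a: "a \<in> grid n m" and sp: "special n m x a" by blast
  note row = special_Inl[OF sp] and path = special_Inr[OF sp]
  have ip: "ipoint (x a) = Some a"
    using row[of "fst a"] a by (auto simp: grid_def)
  show "h1 n m x"
    unfolding h1_def
  proof (intro bexI[of _ "snd a"] bexI[of _ a] conjI ballI)
    fix b' assume "b' \<in> {1..m}"
    then show "(\<forall>i\<in>{1..n}. val (x (i, b'))) \<longleftrightarrow> b' = snd a"
      using special_column[OF sp] special_other_column[OF x a sp] by blast
  next
    fix a' assume a': "a' \<in> {1..n} \<times> {snd a}"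
    show "x a' \<noteq> (True, None, None, None) \<longleftrightarrow> a' = a"
      \<comment> \<open>The cell \<open>a\<close> itself differs from the blank symbol because its
        \<open>ipoint\<close> is not null.\<close>
      using row[of "fst a'"] a' ip
      by (cases a; cases a') (auto simp: ipoint_def split: if_splits)
  next
    fix j assume "j \<in> {1..m} - {snd a}"
    then show "\<exists>l. follow x a (tree_path m j) = Some l \<and> snd l = j \<and> \<not> val (x l)"
      using path[of j] by (auto simp: reaches_zero_def)
  qed (use a ip in \<open>auto simp: grid_def\<close>)
qed

section \<open>The degree bound\<close>

text \<open>There are \<open>n + m\<close> conditions per cell, which fixes \<open>d\<close>; the
  bound on \<open>2 ^ s\<close> lets \<open>n * m\<close> errors of size \<open>(1/2) ^ s\<close>
  add up to at most 1/10.\<close>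

lemma approx_deg_h1_tilde_le:
  assumes enc: "encoding n m \<beta>" and n: "n \<ge> 1" and m: "m \<ge> 1"
    and d: "n + m \<le> d ^ 2" and s: "10 * (n * m) \<le> 2 ^ s"
  shows "approx_deg (n * m * blk n m) (h1_tilde n m \<beta>)
    \<le> s * (d * ((tree_depth m + 2) * blk n m))"
proof -
  let ?K = "{1..n} <+> {1..m}"
  let ?D = "s * (d * ((tree_depth m + 2) * blk n m))"
  let ?S = "\<lambda>y a. special n m (decode n m \<beta> y) a"
  have "card ?K = n + m" by (simp add: card_Plus)
  then have "\<exists>q. degle (n * m * blk n m) ?D q \<and>
      (\<forall>y. \<bar>q y - of_bool (?S y a)\<bar> \<le> of_bool (\<not> ?S y a) * (1/2) ^ s)" if "a \<in> grid n m" for a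
    unfolding special_def
    using n m d degle_special_cond[OF enc that] by (intro degle_conjunction) auto
  then obtain q where deg: "\<And>a. a \<in> grid n m \<Longrightarrow> degle (n * m * blk n m) ?D (q a)"
    and err: "\<And>a y. a \<in> grid n m \<Longrightarrow>
      \<bar>q a y - of_bool (?S y a)\<bar> \<le> of_bool (\<not> ?S y a) * (1/2) ^ s"
    by metis
  have fin: "finite (grid n m)" by (simp add: grid_def)
  \<comment> \<open>By uniqueness at most one indicator is 1, so the disjunction over cells is an
    exact sum.\<close>
  have sum: "h1_tilde n m \<beta> y = (\<Sum>a\<in>grid n m. of_bool (?S y a))" for y
  proof (cases "\<exists>a\<in>grid n m. ?S y a")
    case True
    then obtain a where a: "a \<in> grid n m" "?S y a" by blast
    have "?S y a' \<longleftrightarrow> a' = a" if "a' \<in> grid n m" for a'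
      using special_unique[OF decode_in_Sigma[OF enc] a that] a(2) by blast
    then have "of_bool (?S y a') = (if a' = a then 1 else 0 :: real)" if "a' \<in> grid n m" for a'
      using that by simp
    then have "(\<Sum>a\<in>grid n m. of_bool (?S y a)) = (\<Sum>a'\<in>grid n m. if a' = a then 1 else 0 :: real)"
      by (rule sum.cong[OF refl])
    also have "\<dots> = 1" using a fin by simp
    finally show ?thesis
      using True h1_iff_special[OF decode_in_Sigma[OF enc]] by (simp add: h1_tilde_def)
  next
    case False
    then show ?thesis
      using h1_iff_special[OF decode_in_Sigma[OF enc]] by (simp add: h1_tilde_def)
  qed
  have "real (10 * (n * m)) \<le> real (2 ^ s)"
    using s by (rule of_nat_mono)
  then have small: "real (n * m) * (1/2) ^ s \<le> 1/10"
    by (simp add: power_divide divide_simps)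
  have "\<bar>(\<Sum>a\<in>grid n m. q a y) - h1_tilde n m \<beta> y\<bar> \<le> 1/10" for y
  proof -
    have "\<bar>(\<Sum>a\<in>grid n m. q a y) - h1_tilde n m \<beta> y\<bar>
        = \<bar>\<Sum>a\<in>grid n m. q a y - of_bool (?S y a)\<bar>"
      by (simp add: sum sum_subtractf)
    also have "\<dots> \<le> (\<Sum>a\<in>grid n m. \<bar>q a y - of_bool (?S y a)\<bar>)"
      by (rule sum_abs)
    also have "\<dots> \<le> (\<Sum>a\<in>grid n m. (1/2) ^ s)"
      by (intro sum_mono order_trans[OF err]) auto
    also have "\<dots> = real (n * m) * (1/2) ^ s"
      by (simp add: grid_def card_cartesian_product)
    finally show ?thesis using small by linarith
  qed
  moreover have "degle (n * m * blk n m) ?D (\<lambda>y. \<Sum>a\<in>grid n m. q a y)"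
    by (intro degle_sum deg)
  ultimately show ?thesis by (intro approx_deg_le)
qed

section \<open>Logarithmic bounds on the parameters\<close>

lemma card_Sigma_alph: "card (Sigma_alph n m) = 2 * (n * m + 1) ^ 3"
proof -
  have "card (ptrs n m) = n * m + 1"
    by (simp add: ptrs_def grid_def card_image card_insert_if image_iff card_cartesian_product)
  then show ?thesis
    by (simp add: Sigma_alph_def card_cartesian_product power3_eq_cube card_UNIV_bool)
qed

lemma log2_le_ln:
  assumes "(x::real) \<ge> 1"
  shows "log 2 x \<le> 2 * ln x"
proof -
  \<comment> \<open>This amounts to \<open>ln 2\<close> being at least 1/2.\<close>
  have "ln (1/2 :: real) \<le> -1/2" using ln_le_minus_one[of "1/2"] by simp
  then have "1 \<le> 2 * ln (2::real)" by (simp add: ln_div)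
  then have "ln x * 1 \<le> ln x * (2 * ln 2)"
    using assms by (intro mult_left_mono) auto
  then show ?thesis by (simp add: log_def divide_simps mult_ac)
qed

lemma blk_le:
  assumes "n \<ge> 1" "m \<ge> 1"
  shows "real (blk n m) \<le> 12 * (1 + ln (real (n + m)))"
proof -
  have "n * m + 1 \<le> (n + m) ^ 2"
    using assms by (simp add: power2_eq_square algebra_simps add_le_mono trans_le_add1)
  then have "real (n * m + 1) \<le> real ((n + m) ^ 2)"
    by (rule of_nat_mono)
  then have "real (n * m + 1) \<le> real (n + m) ^ 2"
    by (simp only: of_nat_power)
  then have "log 2 (real (n * m + 1)) \<le> log 2 (real (n + m) ^ 2)"
    by (subst log_le_cancel_iff) (use assms in \<open>auto intro: add_pos_nonneg\<close>)
  also have "\<dots> = 2 * log 2 (real (n + m))"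
    using assms by (simp add: log_nat_power)
  also have "\<dots> \<le> 4 * ln (real (n + m))"
    using log2_le_ln[of "real (n + m)"] assms by simp
  finally have 1: "log 2 (real (n * m + 1)) \<le> 4 * ln (real (n + m))" .
  have "log 2 (real (card (Sigma_alph n m))) = log 2 (2 * real (n * m + 1) ^ 3)"
    by (simp add: card_Sigma_alph)
  also have "\<dots> = 1 + log 2 (real (n * m + 1) ^ 3)"
    by (subst log_mult) (use assms in \<open>simp_all del: of_nat_add of_nat_mult\<close>)
  also have "\<dots> = 1 + 3 * log 2 (real (n * m + 1))"
    by (subst log_nat_power) (simp_all del: of_nat_add of_nat_mult)
  finally have 2: "log 2 (real (card (Sigma_alph n m))) = 1 + 3 * log 2 (real (n * m + 1))" .
  have "log 2 (real (n * m + 1)) \<ge> 0" by (subst zero_le_log_cancel_iff) (auto intro: add_pos_nonneg)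
  \<comment> \<open>One summand 1 pays for the ceiling, the other comes from the factor 2 that
    \<open>val\<close> contributes to the alphabet size.\<close>
  then have "real (blk n m) \<le> 1 + (1 + 3 * log 2 (real (n * m + 1)))"
    unfolding blk_def 2 by linarith
  with 1 show ?thesis by (simp add: algebra_simps)
qed

lemma tree_depth_le:
  assumes "m \<ge> 1"
  shows "real (tree_depth m) \<le> 2 * ln (real m)"
proof -
  have "2 ^ tree_depth m \<le> m"
    unfolding tree_depth_def
  \<comment> \<open>The maximum is attained because 0 qualifies and \<open>y < 2 ^ y\<close> bounds
    all candidates by \<open>m\<close>.\<close>
  proof (rule GreatestI_nat[of "\<lambda>r. 2 ^ r \<le> m" 0 m])
    show "2 ^ 0 \<le> m" using assms by simp
    show "y \<le> m" if "2 ^ y \<le> m" for y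
      using that less_exp[of y] by linarith
  qed
  then have "real (tree_depth m) \<le> log 2 (real m)"
    using assms by (intro le_log2_of_power) auto
  also have "\<dots> \<le> 2 * ln (real m)"
    using assms by (intro log2_le_ln) simp
  finally show ?thesis .
qed

theorem theorem22:
  shows "\<exists>C k. C > 0 \<and> (\<forall>n m \<beta>. n \<ge> 1 \<longrightarrow> m \<ge> 1 \<longrightarrow> encoding n m \<beta> \<longrightarrow>
     real (approx_deg (n * m * blk n m) (h1_tilde n m \<beta>))
       \<le> C * (sqrt (real n) + sqrt (real m)) * (1 + ln (real (n + m))) ^ k)"
proof (intro exI[of _ "240 :: real"] exI[of _ "3 :: nat"] conjI allI impI)
  fix n m :: nat and \<beta>
  assume n: "n \<ge> 1" and m: "m \<ge> 1" and enc: "encoding n m \<beta>"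
  define L where "L = 1 + ln (real (n + m))"
  define Q where "Q = sqrt (real n) + sqrt (real m)"
  define d where "d = nat \<lceil>sqrt (real (n + m))\<rceil>"
  define s where "s = nat \<lceil>log 2 (real (10 * (n * m)))\<rceil>"
  have L: "L \<ge> 1" using n m by (simp add: L_def)
  have Q: "sqrt (real (n + m)) \<le> Q" "1 \<le> Q"
    using sqrt_add_le_add_sqrt[of "real n" "real m"] n m
    by (auto simp: Q_def intro: order_trans[of 1 "sqrt (real n)"] add_increasing2)

  have sq: "sqrt (real (n + m)) \<le> real d" unfolding d_def by linarith
  then have "real (n + m) \<le> real (d ^ 2)"
    using power_mono[OF sq, of 2] by simp
  then have d: "n + m \<le> d ^ 2"
    by (simp only: of_nat_le_iff)
  have "real d \<le> sqrt (real (n + m)) + 1"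
    unfolding d_def using real_sqrt_ge_zero[of "real (n + m)"] by linarith
  \<comment> \<open>The 1 lost to the ceiling is absorbed by \<open>Q\<close>, which is at least
    1.\<close>
  with Q have dQ: "real d \<le> 2 * Q" by linarith

  have nm: "real (10 * (n * m)) > 0" "real (n * m) \<ge> 1"
    using n m by (auto simp flip: of_nat_mult)
  have "log 2 (real (10 * (n * m))) \<le> real s" unfolding s_def by linarith
  then have "real (10 * (n * m)) \<le> 2 powr real s"
    using nm by (subst (asm) log_le_iff) auto
  also have "\<dots> = real (2 ^ s)"
    by (simp add: powr_realpow)
  finally have s: "10 * (n * m) \<le> 2 ^ s"
    by (simp only: of_nat_le_iff)
  \<comment> \<open>Rounding 10 up to a power of two makes its logarithm exactly 4.\<close>
  have "10 * (n * m) \<le> 2 ^ 4 * (n + m) ^ 2"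
    by (simp add: power2_eq_square algebra_simps)
  then have "real (10 * (n * m)) \<le> real (2 ^ 4 * (n + m) ^ 2)"
    by (rule of_nat_mono)
  also have "\<dots> = 2 ^ 4 * real (n + m) ^ 2"
    by simp
  finally have "real (10 * (n * m)) \<le> 2 ^ 4 * real (n + m) ^ 2" .
  then have "log 2 (real (10 * (n * m))) \<le> log 2 (2 ^ 4 * real (n + m) ^ 2)"
    by (subst log_le_cancel_iff) (use n m in auto)
  also have "\<dots> = 4 + 2 * log 2 (real (n + m))"
    using n m log_nat_power[of 2 2 4] by (subst log_mult) (simp_all add: log_nat_power)
  also have "\<dots> \<le> 4 + 4 * ln (real (n + m))"
    using log2_le_ln[of "real (n + m)"] n m by simp
  finally have "log 2 (real (10 * (n * m))) \<le> 4 * L" by (simp add: L_def)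
  \<comment> \<open>The fifth \<open>L\<close> covers the ceiling, since \<open>L\<close> is at
    least 1.\<close>
  then have sL: "real s \<le> 5 * L" unfolding s_def using L by linarith

  have "ln (real m) \<le> ln (real (n + m))"
    using m by (subst ln_le_cancel_iff) auto
  then have rL: "real (tree_depth m + 2) \<le> 2 * L"
    using tree_depth_le[OF m] by (simp add: L_def)
  have bL: "real (blk n m) \<le> 12 * L"
    using blk_le[OF n m] by (simp add: L_def)

  have "real (approx_deg (n * m * blk n m) (h1_tilde n m \<beta>))
      \<le> real (s * (d * ((tree_depth m + 2) * blk n m)))"
    using approx_deg_h1_tilde_le[OF enc n m d s] by (rule of_nat_mono)
  also have "\<dots> = real s * (real d * (real (tree_depth m + 2) * real (blk n m)))"
    by (simp only: of_nat_mult)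
  \<comment> \<open>The constant 240 is 5 * 2 * 2 * 12, and the three factors \<open>L\<close> come
    from \<open>s\<close>, the tree depth and the block length.\<close>
  also have "\<dots> \<le> (5 * L) * ((2 * Q) * ((2 * L) * (12 * L)))"
    using L Q by (intro mult_mono sL dQ rL bL) auto
  also have "\<dots> = 240 * Q * L ^ 3"
    by (simp add: power3_eq_cube)
  finally show "real (approx_deg (n * m * blk n m) (h1_tilde n m \<beta>))
      \<le> 240 * (sqrt (real n) + sqrt (real m)) * (1 + ln (real (n + m))) ^ 3"
    by (simp add: L_def Q_def)
qed simp

end
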